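(* Let $X$ be a Tychonoff space and let $\mathscr{P}$ be an ideal of closed sets in $X$ with $|X_\mathscr{P}|\geq 3$. Then $ecc_G(f)=2=ecc_{AG}(f)$ for each $f\in V(C_\mathscr{P}(X))$, where $ecc_G(f)$ and $ecc_{AG}(f)$ denote the eccentricities of $f$ in $G(C_\mathscr{P}(X))$ and in $AG(C_\mathscr{P}(X))$ respectively.
   Context: $C(X)$ is the ring of all real valued continuous functions on the Tychonoff (completely regular Hausdorff) space $X$; $Z(f)=\{x\in X: f(x)=0\}$. An ideal of closed sets in $X$ is a nonempty family $\mathscr{P}$ of closed subsets of $X$ such that $A,B\in\mathscr{P}$ implies $A\cup B\in\mathscr{P}$, and $A\in\mathscr{P}$, $C\subset A$ with $C$ closed in $X$ implies $C\in\mathscr{P}$. $C_\mathscr{P}(X)=\{f\in C(X): cl_X(X\setminus Z(f))\in\mathscr{P}\}$, a commutative ring (possibly without identity). $X_\mathscr{P}$ is the set of all $x\in X$ having an open neighborhood $V$ with $cl_XV\in\mathscr{P}$. For a commutative ring $R$, $Z(R)^*$ is the set of nonzero zero divisors, i.e. nonzero $a\in R$ with $ab=0$ for some nonzero $b\in R$, and $ann(a)=\{r\in R: ra=0\}$. The annihilator graph $AG(R)$ is the simple graph with vertex set $Z(R)^*$ in which distinct $a,b$ are adjacent iff $ann(a)\cup ann(b)\neq ann(ab)$. On $C_\mathscr{P}(X)$ define the equivalence relation $f\sim g$ iff $int_XZ(f)\cap X_\mathscr{P}=int_XZ(g)\cap X_\mathscr{P}$. Fix a set $S\subset C_\mathscr{P}(X)$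 containing exactly one element of each equivalence class, and put $V(C_\mathscr{P}(X))=\{f\in S\setminus\{0\}: int_XZ(f)\cap X_\mathscr{P}\neq\emptyset\}$, which is a subset of $Z(C_\mathscr{P}(X))^*$. $G(C_\mathscr{P}(X))$ is the induced subgraph of $AG(C_\mathscr{P}(X))$ with vertex set $V(C_\mathscr{P}(X))$. The eccentricity of a vertex $f$ of a graph $H$ is $\max\{d_H(f,g): g \text{ a vertex of } H\}$, where $d_H$ is the length of a shortest path. *)

theory Defs
  imports
    "HOL-Analysis.Analysis"
    "HOL-Library.Function_Algebras"
    "HOL-Library.Extended_Nat"
    "Graph_Theory.Digraph_Component"
begin

section \<open>The ring of continuous functions with support in an ideal of closed sets\<close>

definition closed_ideal :: "'a::topological_space set set \<Rightarrow> bool" where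
  "closed_ideal P \<longleftrightarrow>
     P \<noteq> {} \<and> (\<forall>A\<in>P. closed A) \<and>
     (\<forall>A\<in>P. \<forall>B\<in>P. A \<union> B \<in> P) \<and>
     (\<forall>A\<in>P. \<forall>C. C \<subseteq> A \<and> closed C \<longrightarrow> C \<in> P)"

definition zero_set :: "('a \<Rightarrow> real) \<Rightarrow> 'a set" where
  "zero_set f = {x. f x = 0}"

text \<open>The ring operations are the pointwise ones of \<^theory>\<open>HOL-Library.Function_Algebras\<close>;
  the ring need not have an identity.\<close>

definition C_ideal :: "'a::topological_space set set \<Rightarrow> ('a \<Rightarrow> real) set" where
  "C_ideal P = {f. continuous_on UNIV f \<and> closure (- zero_set f) \<in> P}"

definition X_ideal :: "'a::topological_space set set \<Rightarrow> 'a set" where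
  "X_ideal P = {x. \<exists>V. open V \<and> x \<in> V \<and> closure V \<in> P}"

lemma C_ideal_zero:
  assumes "closed_ideal P"
  shows "0 \<in> C_ideal P"
proof -
  obtain A where "A \<in> P" using assms by (auto simp: closed_ideal_def)
  then have "{} \<in> P" using assms unfolding closed_ideal_def by (meson closed_empty empty_subsetI)
  then show ?thesis by (simp add: C_ideal_def zero_set_def zero_fun_def)
qed

lemma C_ideal_diff:
  assumes P: "closed_ideal P" and f: "f \<in> C_ideal P" and g: "g \<in> C_ideal P"
  shows "f - g \<in> C_ideal P"
proof -
  have "- zero_set (f - g) \<subseteq> - zero_set f \<union> - zero_set g"
    by (auto simp: zero_set_def)
  then have "closure (- zero_set (f - g)) \<subseteq> closure (- zero_set f) \<union> closure (- zero_set g)"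
    using closure_mono closure_Un by metis
  moreover have "closure (- zero_set f) \<union> closure (- zero_set g) \<in> P"
    using P f g by (auto simp: closed_ideal_def C_ideal_def)
  ultimately have "closure (- zero_set (f - g)) \<in> P"
    using P unfolding closed_ideal_def by (meson closed_closure)
  then show ?thesis
    using f g by (auto simp: C_ideal_def fun_diff_def intro: continuous_on_diff)
qed

lemma C_ideal_mult:
  assumes P: "closed_ideal P" and f: "f \<in> C_ideal P" and g: "g \<in> C_ideal P"
  shows "f * g \<in> C_ideal P"
proof -
  have "- zero_set (f * g) \<subseteq> - zero_set f"
    by (auto simp: zero_set_def)
  then have "closure (- zero_set (f * g)) \<subseteq> closure (- zero_set f)"
    by (rule closure_mono)
  then have "closure (- zero_set (f * g)) \<in> P"
    using P f unfolding closed_ideal_def C_ideal_def by (auto; meson closed_closure)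
  then show ?thesis
    using f g by (auto simp: C_ideal_def times_fun_def intro: continuous_on_mult)
qed


section \<open>The annihilator graph of a commutative ring\<close>

text \<open>A commutative ring, possibly without identity, is represented by the carrier set \<open>R\<close> of a
  subring of a type of class \<^class>\<open>comm_ring\<close>. A simple graph is represented by the symmetric
  digraph having both arcs \<open>(a, b)\<close> and \<open>(b, a)\<close> for every edge.\<close>

definition annihilator :: "'r::comm_ring set \<Rightarrow> 'r \<Rightarrow> 'r set" where
  "annihilator R a = {r \<in> R. r * a = 0}"

definition zero_divisors :: "'r::comm_ring set \<Rightarrow> 'r set" where
  "zero_divisors R = {a \<in> R. a \<noteq> 0 \<and> (\<exists>b\<in>R. b \<noteq> 0 \<and> a * b = 0)}"

definition annihilator_graph :: "'r::comm_ring set \<Rightarrow> ('r, 'r \<times> 'r) pre_digraph" where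
  "annihilator_graph R =
     \<lparr> verts = zero_divisors R,
       arcs = {(a, b). a \<in> zero_divisors R \<and> b \<in> zero_divisors R \<and> a \<noteq> b \<and>
                 annihilator R a \<union> annihilator R b \<noteq> annihilator R (a * b)},
       tail = fst, head = snd \<rparr>"

lemma annihilator_graph_loopfree: "loopfree_digraph (annihilator_graph R)"
  by unfold_locales (auto simp: annihilator_graph_def)

lemma annihilator_graph_nomulti: "nomulti_digraph (annihilator_graph R)"
  by unfold_locales (auto simp: annihilator_graph_def arc_to_ends_def)

lemma annihilator_graph_sym: "sym_digraph (annihilator_graph R)"
proof unfold_locales
  show "symmetric (annihilator_graph R)"
    unfolding symmetric_def
    by (rule symI) (auto simp: annihilator_graph_def arcs_ends_def arc_to_ends_def
        image_iff mult.commute Un_commute)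
qed (auto simp: annihilator_graph_def)


section \<open>Distance and eccentricity\<close>

text \<open>The distance is \<open>\<infinity>\<close> if there is no path. The supremum in \<open>eccentricity\<close> is a maximum
  whenever it is finite.\<close>

definition graph_dist :: "('v, 'e) pre_digraph \<Rightarrow> 'v \<Rightarrow> 'v \<Rightarrow> enat" where
  "graph_dist H u v = (INF p \<in> {p. pre_digraph.apath H u p v}. enat (length p))"

definition eccentricity :: "('v, 'e) pre_digraph \<Rightarrow> 'v \<Rightarrow> enat" where
  "eccentricity H u = (SUP v \<in> verts H. graph_dist H u v)"


section \<open>The graph on representatives\<close>

definition zero_int_rel :: "'a::topological_space set set \<Rightarrow> (('a \<Rightarrow> real) \<times> ('a \<Rightarrow> real)) set" where
  "zero_int_rel P = {(f, g). f \<in> C_ideal P \<and> g \<in> C_ideal P \<and>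
     interior (zero_set f) \<inter> X_ideal P = interior (zero_set g) \<inter> X_ideal P}"

lemma equiv_zero_int_rel: "equiv (C_ideal P) (zero_int_rel P)"
  by (rule equivI) (auto simp: zero_int_rel_def refl_on_def sym_def trans_def)

definition is_representative_set :: "'a::topological_space set set \<Rightarrow> ('a \<Rightarrow> real) set \<Rightarrow> bool" where
  "is_representative_set P S \<longleftrightarrow>
     S \<subseteq> C_ideal P \<and> (\<forall>K \<in> C_ideal P // zero_int_rel P. \<exists>!f. f \<in> S \<inter> K)"

definition rep_vertices :: "'a::topological_space set set \<Rightarrow> ('a \<Rightarrow> real) set \<Rightarrow> ('a \<Rightarrow> real) set" where
  "rep_vertices P S = {f \<in> S - {0}. interior (zero_set f) \<inter> X_ideal P \<noteq> {}}"

text \<open>In a Tychonoff space the chosen vertices are vertices of the annihilator graph, so that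
  \<open>rep_graph\<close> below is an induced subgraph in the proper sense.\<close>

lemma rep_vertices_subset_zero_divisors:
  fixes P :: "'a::t2_space set set"
  assumes X: "completely_regular_space (euclidean :: 'a topology)"
    and P: "closed_ideal P" and S: "is_representative_set P S"
  shows "rep_vertices P S \<subseteq> zero_divisors (C_ideal P)"
proof
  fix f assume "f \<in> rep_vertices P S"
  then obtain x where f: "f \<in> C_ideal P" "f \<noteq> 0"
    and x: "x \<in> interior (zero_set f)" "x \<in> X_ideal P"
    using S by (auto simp: rep_vertices_def is_representative_set_def)
  obtain V where V: "open V" "x \<in> V" "closure V \<in> P"
    using x(2) by (auto simp: X_ideal_def)
  define U where "U = V \<inter> interior (zero_set f)"
  have "openin euclidean U" "x \<in> U"
    using V x by (auto simp: U_def)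
  then have "\<exists>h::'a \<Rightarrow> real. continuous_map euclidean euclideanreal h \<and> h x = 0 \<and>
      h ` (topspace euclidean - U) \<subseteq> {1}"
    using X unfolding completely_regular_space_alt' by blast
  then obtain h :: "'a \<Rightarrow> real" where h: "continuous_map euclidean euclideanreal h"
    "h x = 0" "h ` (- U) \<subseteq> {1}"
    by (auto simp: Compl_eq_Diff_UNIV)
  define g where "g = (\<lambda>y. 1 - h y)"
  have cont: "continuous_on UNIV g"
    using h(1) unfolding g_def by (auto intro!: continuous_intros)
  have sub: "- zero_set g \<subseteq> U"
    using h(3) by (auto simp: zero_set_def g_def image_subset_iff)
  then have "closure (- zero_set g) \<subseteq> closure V"
    by (intro closure_mono) (auto simp: U_def)
  then have "closure (- zero_set g) \<in> P"
    using V(3) P unfolding closed_ideal_def by (meson closed_closure)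
  then have "g \<in> C_ideal P"
    using cont by (simp add: C_ideal_def)
  moreover have "g x \<noteq> 0"
    using h(2) by (simp add: g_def)
  then have "g \<noteq> 0" by auto
  moreover have "f * g = 0"
  proof
    fix y
    show "(f * g) y = 0 y"
      using sub interior_subset[of "zero_set f"] by (auto simp: U_def zero_set_def subset_iff)
  qed
  ultimately show "f \<in> zero_divisors (C_ideal P)"
    using f by (auto simp: zero_divisors_def)
qed

definition rep_graph :: "'a::topological_space set set \<Rightarrow> ('a \<Rightarrow> real) set \<Rightarrow>
    ('a \<Rightarrow> real, ('a \<Rightarrow> real) \<times> ('a \<Rightarrow> real)) pre_digraph" where
  "rep_graph P S = induce_subgraph (annihilator_graph (C_ideal P)) (rep_vertices P S)"

end

theory Submission
  imports Defs
begin

text \<open>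
  The ring \<open>R = C_ideal P\<close> is reduced, and in a reduced ring two elements are adjacent in the
  annihilator graph exactly when their annihilators are incomparable
  (\<open>annihilator_mult_neq_iff\<close>). Adjacency therefore depends only on the annihilators, so that
  it makes no difference for the eccentricity of \<open>f\<close> whether all zero divisors are taken as
  vertices or only a subset \<open>V\<close> that still realises every annihilator. Both graphs of the
  theorem are of this form, because \<open>interior (zero_set f) \<inter> X_ideal P\<close> determines the
  annihilator of \<open>f\<close>, and they are treated together.

  Eccentricity at most 2: if \<open>f\<close> and \<open>g\<close> are not adjacent, then one annihilator contains the other,
  and any nonzero element \<open>x\<close> of the smaller one satisfies \<open>x f = x g = 0\<close>. Nonzero elements with
  product zero are always adjacent, so \<open>x\<close> is a common neighbour of \<open>f\<close> and \<open>g\<close>.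

  Eccentricity at least 2: what is needed is a zero divisor whose annihilator is comparable to
  that of \<open>f\<close> but different from it (\<open>comparable_zero_divisor\<close>). As \<open>X_ideal P\<close> has three
  points, two of them lie in the interior of the zero set of \<open>f\<close>, or two of them lie outside. In
  the first case the support of \<open>f\<close> can be enlarged near one point without meeting a
  neighbourhood of the other; in the second case \<open>f\<close> can be cut down to a neighbourhood of one
  point and thereby be killed near the other. Complete regularity supplies the bump functions.
\<close>

section \<open>Digraphs in which a vertex has eccentricity two\<close>

text \<open>The paths in \<open>graph_dist\<close> must not repeat a vertex; without loops, a common neighbour of two
  vertices is different from both, so that passing through it is such a path.\<close>

lemma eccentricity_eq_2I:
  assumes tail: "tail H = fst" and head: "head H = snd"
    and loopfree: "\<And>a. (a, a) \<notin> arcs H"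
    and u: "u \<in> verts H"
    and near: "\<And>v. v \<in> verts H \<Longrightarrow> v \<noteq> u \<Longrightarrow> (u, v) \<notin> arcs H \<Longrightarrow>
                 \<exists>w. (u, w) \<in> arcs H \<and> (w, v) \<in> arcs H"
    and v: "v \<in> verts H" "v \<noteq> u" "(u, v) \<notin> arcs H"
  shows "eccentricity H u = 2"
proof (rule antisym)
  have dist_le: "graph_dist H u w \<le> enat n"
    if "pre_digraph.apath H u p w" "length p \<le> n" for p w n
  proof -
    have "graph_dist H u w \<le> enat (length p)"
      unfolding graph_dist_def using that(1) by (intro INF_lower) simp
    also have "\<dots> \<le> enat n" using that(2) by simp
    finally show ?thesis .
  qed
  note path_defs = pre_digraph.apath_def pre_digraph.awalk_def pre_digraph.cas.simps
    pre_digraph.awalk_verts.simps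
  have "graph_dist H u w \<le> enat 2" if w: "w \<in> verts H" for w
  proof -
    consider "w = u" | "w \<noteq> u" "(u, w) \<in> arcs H" | "w \<noteq> u" "(u, w) \<notin> arcs H" by blast
    then show ?thesis
    proof cases
      case 1
      then have "pre_digraph.apath H u [] w" using u by (simp add: path_defs)
      then show ?thesis by (rule dist_le) simp
    next
      case 2
      then have "pre_digraph.apath H u [(u, w)] w" using u by (simp add: path_defs tail head)
      then show ?thesis by (rule dist_le) simp
    next
      case 3
      then obtain x where x: "(u, x) \<in> arcs H" "(x, w) \<in> arcs H" using near w by blast
      with loopfree have "x \<noteq> u" "x \<noteq> w" by auto
      with x 3 u have "pre_digraph.apath H u [(u, x), (x, w)] w"
        by (simp add: path_defs tail head)
      then show ?thesis by (rule dist_le) simp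
    qed
  qed
  then show "eccentricity H u \<le> 2"
    unfolding eccentricity_def by (intro SUP_least) (simp add: numeral_eq_enat)
next
  have "2 \<le> length p" if p: "pre_digraph.apath H u p v" for p
  proof (rule ccontr)
    assume "\<not> 2 \<le> length p"
    then consider "p = []" | e where "p = [e]"
      by (cases p; cases "tl p") auto
    then show False
      using p v by cases (auto simp: pre_digraph.apath_def pre_digraph.awalk_def
          pre_digraph.cas.simps tail head)
  qed
  then have "enat 2 \<le> graph_dist H u v"
    unfolding graph_dist_def by (intro INF_greatest) auto
  also have "\<dots> \<le> eccentricity H u"
    unfolding eccentricity_def using v(1) by (rule SUP_upper)
  finally show "2 \<le> eccentricity H u" by (simp add: numeral_eq_enat)
qed


section \<open>The annihilator graph of a reduced ring\<close>

locale reduced_subring =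
  fixes R :: "'r::comm_ring set"
  assumes zero_closed: "0 \<in> R"
    and diff_closed: "a \<in> R \<Longrightarrow> b \<in> R \<Longrightarrow> a - b \<in> R"
    and mult_closed: "a \<in> R \<Longrightarrow> b \<in> R \<Longrightarrow> a * b \<in> R"
    and reduced: "a \<in> R \<Longrightarrow> a * a = 0 \<Longrightarrow> a = 0"
begin

lemma add_closed: "a \<in> R \<Longrightarrow> b \<in> R \<Longrightarrow> a + b \<in> R"
  using diff_closed[of a "0 - b"] diff_closed[of 0 b] zero_closed by simp

lemma mult_square_eq_0:
  assumes "a \<in> R" "b \<in> R" "a * b * b = 0"
  shows "a * b = 0"
proof (rule reduced)
  have "a * b * (a * b) = a * (a * b * b)" by (simp add: algebra_simps)
  then show "a * b * (a * b) = 0" using assms(3) by simp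
qed (use assms mult_closed in auto)

lemma annihilator_mult_subset:
  assumes "a \<in> R" "b \<in> R" "annihilator R a \<subseteq> annihilator R b"
  shows "annihilator R (a * b) \<subseteq> annihilator R b"
proof
  fix r assume "r \<in> annihilator R (a * b)"
  then have r: "r \<in> R" "r * b * a = 0" by (auto simp: annihilator_def algebra_simps)
  then have "r * b \<in> annihilator R a" using assms mult_closed by (auto simp: annihilator_def)
  then have "r * b * b = 0" using assms(3) by (auto simp: annihilator_def)
  then show "r \<in> annihilator R b"
    using r(1) assms mult_square_eq_0 by (auto simp: annihilator_def)
qed

text \<open>If the annihilators are incomparable, the sum of a witness for one non-inclusion and a witness
  for the other annihilates the product but neither factor. Conversely, if the annihilator of \<open>a\<close>
  lies in that of \<open>b\<close>, then \<open>r a b = 0\<close> gives \<open>r b b = 0\<close>, and reducedness gives \<open>r b = 0\<close>.\<close>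

lemma annihilator_mult_neq_iff:
  assumes a: "a \<in> R" and b: "b \<in> R"
  shows "annihilator R a \<union> annihilator R b \<noteq> annihilator R (a * b) \<longleftrightarrow>
         \<not> annihilator R a \<subseteq> annihilator R b \<and> \<not> annihilator R b \<subseteq> annihilator R a"
proof
  have sub: "annihilator R a \<union> annihilator R b \<subseteq> annihilator R (a * b)"
  proof -
    have "r * (a * b) = 0" if "r * a = 0 \<or> r * b = 0" for r
      using that mult.assoc[of r a b] mult.left_commute[of r a b]
      by (metis mult_zero_left mult_zero_right)
    then show ?thesis by (auto simp: annihilator_def)
  qed
  assume neq: "annihilator R a \<union> annihilator R b \<noteq> annihilator R (a * b)"
  show "\<not> annihilator R a \<subseteq> annihilator R b \<and> \<not> annihilator R b \<subseteq> annihilator R a"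
    using sub neq annihilator_mult_subset[OF a b] annihilator_mult_subset[OF b a]
    by (auto simp: mult.commute)
next
  assume "\<not> annihilator R a \<subseteq> annihilator R b \<and> \<not> annihilator R b \<subseteq> annihilator R a"
  then obtain x y where x: "x \<in> R" "x * a = 0" "x * b \<noteq> 0" and y: "y \<in> R" "y * b = 0" "y * a \<noteq> 0"
    by (auto simp: annihilator_def)
  have "(x + y) * (a * b) = x * a * b + y * b * a" by (simp add: algebra_simps)
  then have "x + y \<in> annihilator R (a * b)"
    using x y add_closed by (simp add: annihilator_def)
  moreover have "x + y \<notin> annihilator R a \<union> annihilator R b"
    using x y by (simp add: annihilator_def distrib_right)
  ultimately show "annihilator R a \<union> annihilator R b \<noteq> annihilator R (a * b)" by blast
qed

text \<open>Each of the two elements lies in the annihilator of the other but, by reducedness, not in its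
  own.\<close>

lemma annihilators_incomparable:
  assumes "a \<in> R" "b \<in> R" "a \<noteq> 0" "b \<noteq> 0" "a * b = 0"
  shows "\<not> annihilator R a \<subseteq> annihilator R b" "\<not> annihilator R b \<subseteq> annihilator R a"
  using assms reduced by (auto simp: annihilator_def mult.commute)

lemma common_annihilating_zero_divisor:
  assumes a: "a \<in> zero_divisors R" and b: "b \<in> zero_divisors R"
    and sub: "annihilator R a \<subseteq> annihilator R b"
  shows "\<exists>x \<in> zero_divisors R. a * x = 0 \<and> b * x = 0"
proof -
  obtain x where x: "x \<in> R" "x \<noteq> 0" "a * x = 0" using a by (auto simp: zero_divisors_def)
  then have "x \<in> annihilator R a" by (simp add: annihilator_def mult.commute)
  then have bx: "b * x = 0" using sub by (auto simp: annihilator_def mult.commute)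
  have "x * a = 0" using x(3) by (simp add: mult.commute)
  then have "x \<in> zero_divisors R" using x a unfolding zero_divisors_def by blast
  then show ?thesis using x(3) bx by blast
qed

text \<open>The induced subgraph on a set \<open>V\<close> that meets every class of zero divisors with equal
  annihilators behaves like the full annihilator graph, since common neighbours and non-neighbours
  can be moved into \<open>V\<close> without changing their annihilators.\<close>

lemma eccentricity_induced_annihilator_graph:
  assumes V: "V \<subseteq> zero_divisors R"
    and meets: "\<And>a. a \<in> zero_divisors R \<Longrightarrow> \<exists>b\<in>V. annihilator R b = annihilator R a"
    and f: "f \<in> V"
    and g: "g \<in> zero_divisors R" "annihilator R g \<noteq> annihilator R f"
      "annihilator R f \<subseteq> annihilator R g \<or> annihilator R g \<subseteq> annihilator R f"
  shows "eccentricity (induce_subgraph (annihilator_graph R) V) f = 2"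
proof -
  let ?H = "induce_subgraph (annihilator_graph R) V"
  have VR: "V \<subseteq> R" using V by (auto simp: zero_divisors_def)
  have adj: "(a, b) \<in> arcs ?H \<longleftrightarrow> a \<in> V \<and> b \<in> V \<and>
      \<not> annihilator R a \<subseteq> annihilator R b \<and> \<not> annihilator R b \<subseteq> annihilator R a" for a b
  proof (cases "a \<in> V \<and> b \<in> V")
    case True
    then have "a \<in> R" "b \<in> R" using VR by auto
    from annihilator_mult_neq_iff[OF this] True V show ?thesis
      by (auto simp: induce_subgraph_def annihilator_graph_def)
  qed (auto simp: induce_subgraph_def annihilator_graph_def)
  obtain h where h: "h \<in> V" "annihilator R h = annihilator R g" using meets g(1) by blast
  show ?thesis
  proof (rule eccentricity_eq_2I[where v = h])
    show "f \<in> verts ?H" "h \<in> verts ?H" using f h by (simp_all add: induce_subgraph_def)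
    show "h \<noteq> f" using g(2) h(2) by auto
    show "(f, h) \<notin> arcs ?H" unfolding adj using g(3) h(2) by auto
    show "(a, a) \<notin> arcs ?H" for a unfolding adj by blast
    show "tail ?H = fst" "head ?H = snd"
      by (simp_all add: induce_subgraph_def annihilator_graph_def)
    fix v assume v: "v \<in> verts ?H" and "(f, v) \<notin> arcs ?H"
    then have vV: "v \<in> V" by (simp add: induce_subgraph_def)
    have fz: "f \<in> zero_divisors R" and vz: "v \<in> zero_divisors R" using V f vV by auto
    have "annihilator R f \<subseteq> annihilator R v \<or> annihilator R v \<subseteq> annihilator R f"
      using \<open>(f, v) \<notin> arcs ?H\<close> f vV unfolding adj by blast
    then obtain x where x: "x \<in> zero_divisors R" "f * x = 0" "v * x = 0"
      using common_annihilating_zero_divisor fz vz by blast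
    then obtain w where w: "w \<in> V" "annihilator R w = annihilator R x" using meets by blast
    have "\<not> annihilator R f \<subseteq> annihilator R x" "\<not> annihilator R x \<subseteq> annihilator R f"
      "\<not> annihilator R v \<subseteq> annihilator R x" "\<not> annihilator R x \<subseteq> annihilator R v"
      using annihilators_incomparable[of f x] annihilators_incomparable[of v x] x fz vz
      by (simp_all add: zero_divisors_def)
    then show "\<exists>w. (f, w) \<in> arcs ?H \<and> (w, v) \<in> arcs ?H"
      using w f vV unfolding adj by auto
  qed
qed

end


section \<open>Annihilators in the ring of continuous functions\<close>

lemma reduced_subring_C_ideal:
  fixes P :: "'a::topological_space set set"
  assumes "closed_ideal P"
  shows "reduced_subring (C_ideal P)"
proof
  fix a :: "'a \<Rightarrow> real" assume "a * a = 0"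
  then show "a = 0" by (auto simp: fun_eq_iff)
qed (use assms C_ideal_zero C_ideal_diff C_ideal_mult in auto)

lemma mem_C_idealI:
  assumes P: "closed_ideal P" and "A \<in> P" and "closed A" and "continuous_on UNIV g"
    and "- zero_set g \<subseteq> A"
  shows "g \<in> C_ideal P"
proof -
  have "closure (- zero_set g) \<subseteq> A" using assms by (intro closure_minimal)
  then have "closure (- zero_set g) \<in> P"
    using P \<open>A \<in> P\<close> unfolding closed_ideal_def by (meson closed_closure)
  then show ?thesis using assms by (simp add: C_ideal_def)
qed

lemma bump_function_exists:
  fixes P :: "'a::t2_space set set"
  assumes X: "completely_regular_space (euclidean :: 'a topology)"
    and P: "closed_ideal P" and U: "open U" "x \<in> U" and x: "x \<in> X_ideal P"
  obtains h where "h \<in> C_ideal P" "h x = 1" "\<And>y. y \<notin> U \<Longrightarrow> h y = 0"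
proof -
  obtain V where V: "open V" "x \<in> V" "closure V \<in> P" using x by (auto simp: X_ideal_def)
  have "openin euclidean (V \<inter> U)" "x \<in> V \<inter> U" using V U by auto
  then obtain k :: "'a \<Rightarrow> real" where k: "continuous_map euclidean euclideanreal k"
    "k x = 0" "k ` (topspace euclidean - V \<inter> U) \<subseteq> {1}"
    using X unfolding completely_regular_space_alt' by blast
  define h where "h y = 1 - k y" for y
  have off: "h y = 0" if "y \<notin> V \<inter> U" for y
    using k(3) that by (auto simp: h_def image_subset_iff)
  have "continuous_on UNIV h"
    using k(1) unfolding h_def by (auto intro!: continuous_intros)
  moreover have "- zero_set h \<subseteq> closure V"
  proof
    fix y assume "y \<in> - zero_set h"
    then have "y \<in> V" using off by (auto simp: zero_set_def)
    then show "y \<in> closure V" using closure_subset by blast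
  qed
  ultimately have "h \<in> C_ideal P"
    using mem_C_idealI[OF P V(3)] by simp
  then show thesis using that[of h] k(2) off by (simp add: h_def)
qed

lemma open_nonzero:
  assumes "f \<in> C_ideal P"
  shows "open (- zero_set f)"
proof -
  have "open {x. f x \<noteq> 0}" using assms by (intro open_Collect_neq) (auto simp: C_ideal_def)
  then show ?thesis by (simp add: zero_set_def Compl_eq)
qed

lemma nonzero_subset_X_ideal:
  assumes "f \<in> C_ideal P"
  shows "- zero_set f \<subseteq> X_ideal P"
proof -
  have "closure (- zero_set f) \<in> P" using assms by (simp add: C_ideal_def)
  with open_nonzero[OF assms] show ?thesis unfolding X_ideal_def by blast
qed

lemma mult_eq_0_iff_interior:
  assumes "r \<in> C_ideal P"
  shows "r * f = 0 \<longleftrightarrow> - zero_set r \<subseteq> interior (zero_set f) \<inter> X_ideal P"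
proof -
  have "r * f = 0 \<longleftrightarrow> - zero_set r \<subseteq> zero_set f"
    by (auto simp: fun_eq_iff zero_set_def)
  also have "\<dots> \<longleftrightarrow> - zero_set r \<subseteq> interior (zero_set f)"
    using open_nonzero[OF assms] interior_subset interior_maximal by blast
  finally show ?thesis using nonzero_subset_X_ideal[OF assms] by blast
qed

lemma annihilator_eq_of_zero_int_rel:
  "(f, g) \<in> zero_int_rel P \<Longrightarrow> annihilator (C_ideal P) f = annihilator (C_ideal P) g"
  by (auto simp: zero_int_rel_def annihilator_def mult_eq_0_iff_interior)

text \<open>The representative \<open>b\<close> of the class of a zero divisor \<open>a\<close> has the same annihilator. As \<open>a\<close>
  does not lie in it, \<open>b\<close> is nonzero; and a nonzero \<open>c\<close> in it is supported in the interior of the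
  zero set of \<open>b\<close>, which therefore meets \<open>X_ideal P\<close>.\<close>

lemma rep_vertices_meet_annihilator_classes:
  assumes P: "closed_ideal P" and S: "is_representative_set P S"
    and a: "a \<in> zero_divisors (C_ideal P)"
  shows "\<exists>b \<in> rep_vertices P S. annihilator (C_ideal P) b = annihilator (C_ideal P) a"
proof -
  interpret reduced_subring "C_ideal P" by (rule reduced_subring_C_ideal[OF P])
  have aR: "a \<in> C_ideal P" "a \<noteq> 0" using a by (simp_all add: zero_divisors_def)
  obtain c where c: "c \<in> C_ideal P" "c \<noteq> 0" "c * a = 0"
    using a by (auto simp: zero_divisors_def mult.commute[of a])
  have "zero_int_rel P `` {a} \<in> C_ideal P // zero_int_rel P" using aR(1) by (rule quotientI)
  then have "\<exists>!b. b \<in> S \<inter> zero_int_rel P `` {a}"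
    using S by (simp only: is_representative_set_def)
  then obtain b where b: "b \<in> S" "(a, b) \<in> zero_int_rel P" by auto
  have ann: "annihilator (C_ideal P) b = annihilator (C_ideal P) a"
    using annihilator_eq_of_zero_int_rel[OF b(2)] by simp
  have "a \<notin> annihilator (C_ideal P) a" using aR reduced[of a] by (auto simp: annihilator_def)
  then have "a \<notin> annihilator (C_ideal P) b" using ann by simp
  then have "b \<noteq> 0" using aR(1) by (auto simp: annihilator_def)
  have "c \<in> annihilator (C_ideal P) b" using ann c by (simp add: annihilator_def)
  then have "c * b = 0" by (simp add: annihilator_def)
  then have "- zero_set c \<subseteq> interior (zero_set b) \<inter> X_ideal P"
    using mult_eq_0_iff_interior c(1) by blast
  moreover have "- zero_set c \<noteq> {}" using c(2) by (auto simp: zero_set_def fun_eq_iff)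
  ultimately have "interior (zero_set b) \<inter> X_ideal P \<noteq> {}" by blast
  then have "b \<in> rep_vertices P S" using b(1) \<open>b \<noteq> 0\<close> by (simp add: rep_vertices_def)
  then show ?thesis using ann by blast
qed


section \<open>Zero divisors with comparable annihilators\<close>

text \<open>With \<open>h\<close> a bump near \<open>p\<close> and \<open>k\<close> a bump near \<open>q\<close>, both inside the zero set of \<open>f\<close>, the
  element \<open>f + h\<close> is killed by \<open>k\<close>. The supports of \<open>f\<close> and \<open>h\<close> are disjoint, so whatever kills
  \<open>f + h\<close> kills \<open>f\<close>, while \<open>h\<close> kills only \<open>f\<close>.\<close>

lemma comparable_zero_divisor_of_two_zeros:
  fixes P :: "'a::t2_space set set"
  assumes X: "completely_regular_space (euclidean :: 'a topology)"
    and P: "closed_ideal P" and f: "f \<in> C_ideal P"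
    and pq: "p \<in> interior (zero_set f) \<inter> X_ideal P" "q \<in> interior (zero_set f) \<inter> X_ideal P" "p \<noteq> q"
  shows "\<exists>g \<in> zero_divisors (C_ideal P).
           annihilator (C_ideal P) g \<subset> annihilator (C_ideal P) f"
proof -
  interpret reduced_subring "C_ideal P" by (rule reduced_subring_C_ideal[OF P])
  obtain U W where UW: "open U" "open W" "p \<in> U" "q \<in> W" "U \<inter> W = {}"
    using hausdorff[OF pq(3)] by blast
  have Z: "y \<in> interior (zero_set f) \<Longrightarrow> f y = 0" for y
    using interior_subset[of "zero_set f"] by (auto simp: zero_set_def)
  have "open (U \<inter> interior (zero_set f))" "p \<in> U \<inter> interior (zero_set f)" using UW pq by auto
  then obtain h where h: "h \<in> C_ideal P" "h p = 1" "\<And>y. y \<notin> U \<inter> interior (zero_set f) \<Longrightarrow> h y = 0"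
    using bump_function_exists[OF X P] pq(1) by blast
  have "open (W \<inter> interior (zero_set f))" "q \<in> W \<inter> interior (zero_set f)" using UW pq by auto
  then obtain k where k: "k \<in> C_ideal P" "k q = 1" "\<And>y. y \<notin> W \<inter> interior (zero_set f) \<Longrightarrow> k y = 0"
    using bump_function_exists[OF X P] pq(2) by blast
  have fh: "f y * h y = 0" for y using h(3)[of y] Z by (cases "h y = 0") auto
  let ?g = "f + h"
  have gR: "?g \<in> C_ideal P" using f h add_closed by blast
  have gp: "?g p \<noteq> 0" using h(2) Z pq by auto
  have kg: "?g y * k y = 0" for y
  proof (cases "y \<in> W \<inter> interior (zero_set f)")
    case True
    then have "y \<notin> U" using UW(5) by blast
    then show ?thesis using True h(3)[of y] Z[of y] by simp
  qed (simp add: k(3))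
  have "?g * k = 0" using kg by (auto simp: fun_eq_iff)
  moreover have "k \<noteq> 0" using k(2) by auto
  moreover have "?g \<noteq> 0" using gp by (metis zero_fun_apply)
  ultimately have "?g \<in> zero_divisors (C_ideal P)"
    using gR k(1) unfolding zero_divisors_def by blast
  moreover have "annihilator (C_ideal P) ?g \<subseteq> annihilator (C_ideal P) f"
  proof
    fix r assume r: "r \<in> annihilator (C_ideal P) ?g"
    then have "r y * (f y + h y) = 0" for y by (auto simp: annihilator_def fun_eq_iff)
    then have "r y * f y = 0" for y using fh[of y] by (smt (verit) mult_eq_0_iff)
    then show "r \<in> annihilator (C_ideal P) f" using r by (auto simp: annihilator_def fun_eq_iff)
  qed
  moreover have "h \<in> annihilator (C_ideal P) f"
    using h(1) fh by (auto simp: annihilator_def fun_eq_iff)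
  moreover have "(h * ?g) p \<noteq> 0" using gp h(2) by simp
  then have "h * ?g \<noteq> 0" by (metis zero_fun_apply)
  then have "h \<notin> annihilator (C_ideal P) ?g" by (simp add: annihilator_def)
  ultimately show ?thesis by blast
qed

text \<open>The points \<open>p\<close> and \<open>q\<close> may be zeros of \<open>f\<close>, but every neighbourhood of them contains points
  at which \<open>f\<close> does not vanish, so they can be moved to such points \<open>p'\<close> and \<open>q'\<close>. With bumps
  \<open>h\<close> near \<open>p'\<close> and \<open>k\<close> near \<open>q'\<close>, the element \<open>f h\<close> is nonzero and is killed by \<open>k\<close>, which
  does not kill \<open>f\<close>.\<close>

lemma comparable_zero_divisor_of_two_nonzeros:
  fixes P :: "'a::t2_space set set"
  assumes X: "completely_regular_space (euclidean :: 'a topology)"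
    and P: "closed_ideal P" and f: "f \<in> zero_divisors (C_ideal P)"
    and pq: "p \<notin> interior (zero_set f)" "q \<notin> interior (zero_set f)" "p \<noteq> q"
  shows "\<exists>g \<in> zero_divisors (C_ideal P).
           annihilator (C_ideal P) f \<subset> annihilator (C_ideal P) g"
proof -
  interpret reduced_subring "C_ideal P" by (rule reduced_subring_C_ideal[OF P])
  have fR: "f \<in> C_ideal P" using f by (simp add: zero_divisors_def)
  obtain U W where UW: "open U" "open W" "p \<in> U" "q \<in> W" "U \<inter> W = {}"
    using hausdorff[OF pq(3)] by blast
  obtain p' where p': "p' \<in> U" "f p' \<noteq> 0"
    using pq(1) UW interior_maximal[of U "zero_set f"] by (auto simp: zero_set_def)
  obtain q' where q': "q' \<in> W" "f q' \<noteq> 0"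
    using pq(2) UW interior_maximal[of W "zero_set f"] by (auto simp: zero_set_def)
  have Y: "p' \<in> X_ideal P" "q' \<in> X_ideal P"
    using nonzero_subset_X_ideal[OF fR] p' q' by (auto simp: zero_set_def)
  obtain h where h: "h \<in> C_ideal P" "h p' = 1" "\<And>y. y \<notin> U \<Longrightarrow> h y = 0"
    using bump_function_exists[OF X P UW(1) p'(1) Y(1)] by blast
  obtain k where k: "k \<in> C_ideal P" "k q' = 1" "\<And>y. y \<notin> W \<Longrightarrow> k y = 0"
    using bump_function_exists[OF X P UW(2) q'(1) Y(2)] by blast
  let ?g = "f * h"
  have gR: "?g \<in> C_ideal P" using fR h mult_closed by blast
  have kg: "k y * ?g y = 0" for y using h(3)[of y] k(3)[of y] UW(5) by auto
  have kg0: "k * ?g = 0" using kg by (auto simp: fun_eq_iff)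
  have "?g p' \<noteq> 0" using p' h(2) by simp
  then have "?g \<noteq> 0" by (metis zero_fun_apply)
  moreover have "k \<noteq> 0" using k(2) by auto
  ultimately have "?g \<in> zero_divisors (C_ideal P)"
    using gR k(1) kg0 by (auto simp: zero_divisors_def mult.commute)
  moreover have "annihilator (C_ideal P) f \<subseteq> annihilator (C_ideal P) ?g"
    by (auto simp: annihilator_def fun_eq_iff)
  moreover have "k \<in> annihilator (C_ideal P) ?g" using k(1) kg0 by (simp add: annihilator_def)
  moreover have "(k * f) q' \<noteq> 0" using k(2) q' by simp
  then have "k * f \<noteq> 0" by (metis zero_fun_apply)
  then have "k \<notin> annihilator (C_ideal P) f" by (simp add: annihilator_def)
  ultimately show ?thesis by blast
qed

lemma two_points_inside_or_outside:
  assumes "infinite Y \<or> card Y \<ge> 3"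
  obtains p q where "p \<noteq> q" "p \<in> A \<inter> Y" "q \<in> A \<inter> Y" | p q where "p \<noteq> q" "p \<in> Y - A" "q \<in> Y - A"
proof -
  have "\<exists>T. T \<subseteq> Y \<and> card T = 3"
    using assms infinite_arbitrarily_large[of Y 3] obtain_subset_with_card_n[of 3 Y] by metis
  then obtain x y z where "{x, y, z} \<subseteq> Y" "x \<noteq> y" "y \<noteq> z" "x \<noteq> z"
    by (auto simp: card_3_iff)
  then show thesis using that by (cases "x \<in> A"; cases "y \<in> A"; cases "z \<in> A") auto
qed

lemma comparable_zero_divisor:
  fixes P :: "'a::t2_space set set"
  assumes X: "completely_regular_space (euclidean :: 'a topology)"
    and P: "closed_ideal P" and Y: "infinite (X_ideal P) \<or> card (X_ideal P) \<ge> 3"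
    and f: "f \<in> zero_divisors (C_ideal P)"
  obtains g where "g \<in> zero_divisors (C_ideal P)"
    "annihilator (C_ideal P) g \<noteq> annihilator (C_ideal P) f"
    "annihilator (C_ideal P) f \<subseteq> annihilator (C_ideal P) g \<or>
     annihilator (C_ideal P) g \<subseteq> annihilator (C_ideal P) f"
proof (cases rule: two_points_inside_or_outside[OF Y, of "interior (zero_set f)"])
  case (1 p q)
  have "f \<in> C_ideal P" using f by (simp add: zero_divisors_def)
  from comparable_zero_divisor_of_two_zeros[OF X P this 1(2,3,1)] show thesis
    using that by blast
next
  case (2 p q)
  then show thesis
    using comparable_zero_divisor_of_two_nonzeros[OF X P f, of p q] that by blast
qed


section \<open>Eccentricities\<close>

theorem theorem4p8:
  fixes P :: "'a::t2_space set set" and S :: "('a \<Rightarrow> real) set"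
  assumes "completely_regular_space (euclidean :: 'a topology)"
    and "closed_ideal P"
    and "infinite (X_ideal P) \<or> card (X_ideal P) \<ge> 3"
    and "is_representative_set P S"
    and "f \<in> rep_vertices P S"
  shows "eccentricity (rep_graph P S) f = 2 \<and>
         eccentricity (annihilator_graph (C_ideal P)) f = 2"
proof
  let ?R = "C_ideal P"
  interpret reduced_subring ?R by (rule reduced_subring_C_ideal[OF assms(2)])
  have V: "rep_vertices P S \<subseteq> zero_divisors ?R"
    using rep_vertices_subset_zero_divisors assms by blast
  with assms(5) have f: "f \<in> zero_divisors ?R" by blast
  obtain g where g: "g \<in> zero_divisors ?R" "annihilator ?R g \<noteq> annihilator ?R f"
    "annihilator ?R f \<subseteq> annihilator ?R g \<or> annihilator ?R g \<subseteq> annihilator ?R f"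
    using comparable_zero_divisor[OF assms(1,2,3) f] by blast
  show "eccentricity (rep_graph P S) f = 2"
    unfolding rep_graph_def
    by (rule eccentricity_induced_annihilator_graph[OF V _ assms(5) g])
      (rule rep_vertices_meet_annihilator_classes[OF assms(2,4)])
  have "annihilator_graph ?R = induce_subgraph (annihilator_graph ?R) (zero_divisors ?R)"
    by (auto simp: induce_subgraph_def annihilator_graph_def)
  moreover have "eccentricity (induce_subgraph (annihilator_graph ?R) (zero_divisors ?R)) f = 2"
    by (rule eccentricity_induced_annihilator_graph[OF subset_refl _ f g]) blast
  ultimately show "eccentricity (annihilator_graph ?R) f = 2" by simp
qed

end
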